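(* Let $\mathcal{G}$ be an undirected connected graph on $n\ge 2$ nodes with Laplacian matrix $\mathcal{L}$, and let $f_1,\dots,f_n:\mathbb{R}\to\mathbb{R}$ satisfy the standing assumption on the objective functions stated in the context, with constants $l_0,l>0$. Let $T_c>0$, let $x_1(0),\dots,x_n(0)\in\mathbb{R}$ be arbitrary, and put $C=\sum_{i=1}^n x_i(0)$. Let $\bm{x}^*$ be the unique minimizer of $f(\bm{x})=\sum_{i=1}^n f_i(x_i)$ over $\{\bm{x}\in\mathbb{R}^n:\sum_{i=1}^n x_i=C\}$. Let $\bm{x}(t)=[x_1(t),\dots,x_n(t)]^T$ be generated by the reduced-order sampled-data algorithm described in the context, with a constant $\beta$ satisfying $0<\beta\le \frac{1}{l\|\mathcal{L}\|^2}$ and with sampling instants $t_0=0$, $t_k=\sum_{j=1}^k T_j$ $(k\ge 1)$, $T_k=\frac{6}{(\pi k)^2}T_c$. Then $\bm{x}(t)$ converges to $\bm{x}^*$ at the pre-specified time $T_c$, i.e. $\lim_{t\to T_c^-}\bm{x}(t)=\bm{x}^*$, and $\sum_{i=1}^n x_i(t)=\sum_{i=1}^n x_i(0)=C$ for all $t\in[0,T_c]$, where $\bm{x}(T_c)$ denotes this limit.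
   Context: Graph notation. $\mathcal{G}=(\mathcal{V},\mathcal{E})$ with $\mathcal{V}=\{1,\dots,n\}$ is undirected: $(i,j)\in\mathcal{E}$ iff $(j,i)\in\mathcal{E}$. The adjacency matrix $\mathcal{A}=[a_{ij}]$ has $a_{ii}=0$ and, for $i\ne j$, $a_{ij}=1$ if $(j,i)\in\mathcal{E}$ and $a_{ij}=0$ otherwise. The Laplacian $\mathcal{L}=[l_{ij}]$ has $l_{ii}=\sum_{j=1}^n a_{ij}$ and $l_{ij}=-a_{ij}$ for $i\neq j$. $\|\cdot\|$ is the Euclidean norm for vectors and the induced spectral norm for matrices. Standing assumption on the objective functions. $f(\bm{x})=\sum_{i=1}^n f_i(x_i)$; each $f_i$ is twice differentiable and strongly convex with $\nabla^2 f_i(\cdot)\ge l_0$ for a given $l_0>0$; and $\nabla f$ is Lipschitz: there is $l>0$ with $\|\nabla f(\bm{a})-\nabla f(\bm{b})\|\le l\|\bm{a}-\bm{b}\|$ for all $\bm{a},\bm{b}\in\mathbb{R}^n$. Reduced-order algorithm. For sampling instants $0=t_0<t_1<t_2<\cdots$, for every $k\in\mathbb{N}=\{0,1,2,\dots\}$, $t\in[t_k,t_{k+1})$ and $i\in\{1,\dots,n\}$: $$x_i(t)=x_i(0)-\sum_{j=1}^n a_{ij}\big(\xi_i(t_k)-\xi_j(t_k)\big),$$ $$\dot\xi_i(t)=\frac{\beta}{t_{k+1}-t_k}\sum_{j=1}^n a_{ij}\big(f_i'(x_i(t_k))-f_j'(x_j(t_k))\big),$$ with $\xi_i$ continuous and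 $\xi_i(0)=0$. *)

theory Defs
  imports "HOL-Analysis.Analysis"
begin

text \<open>
  The nodes are the elements of a finite type \<open>'n\<close> and a graph is given by its edge set.
  Self-loops are not excluded, but they do not enter the adjacency matrix.
\<close>

definition undirected_graph :: "('n \<times> 'n) set \<Rightarrow> bool" where
  "undirected_graph E \<longleftrightarrow> sym E"

definition connected_graph :: "('n \<times> 'n) set \<Rightarrow> bool" where
  "connected_graph E \<longleftrightarrow> (\<forall>i j. (i, j) \<in> E\<^sup>*)"

definition adjacency :: "('n::finite \<times> 'n) set \<Rightarrow> real ^ 'n ^ 'n" where
  "adjacency E = (\<chi> i j. if i \<noteq> j \<and> (j, i) \<in> E then 1 else 0)"

definition laplacian :: "('n::finite \<times> 'n) set \<Rightarrow> real ^ 'n ^ 'n" where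
  "laplacian E =
     (\<chi> i j. if i = j then (\<Sum>m\<in>UNIV. adjacency E $ i $ m) else - adjacency E $ i $ j)"

definition spectral_norm :: "real ^ 'n ^ 'n \<Rightarrow> real" where
  "spectral_norm M = onorm (\<lambda>v. M *v v)"

definition objective :: "('n::finite \<Rightarrow> real \<Rightarrow> real) \<Rightarrow> real ^ 'n \<Rightarrow> real" where
  "objective f x = (\<Sum>i\<in>UNIV. f i (x $ i))"

definition gradient :: "('a::real_inner \<Rightarrow> real) \<Rightarrow> 'a \<Rightarrow> 'a" where
  "gradient F x = (THE D. GDERIV F x :> D)"

text \<open>
  For twice differentiable functions of one real variable, strong convexity with modulus
  \<open>l0\<close> is the lower bound \<open>l0\<close> on the second derivative.
\<close>

definition standing_assumption ::
    "('n::finite \<Rightarrow> real \<Rightarrow> real) \<Rightarrow> real \<Rightarrow> real \<Rightarrow> bool" where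
  "standing_assumption f l0 l \<longleftrightarrow>
     l0 > 0 \<and> l > 0 \<and>
     (\<forall>i s. f i differentiable at s) \<and>
     (\<forall>i s. deriv (f i) differentiable at s) \<and>
     (\<forall>i s. deriv (deriv (f i)) s \<ge> l0) \<and>
     (\<forall>a b. norm (gradient (objective f) a - gradient (objective f) b) \<le> l * norm (a - b))"

definition constrained_minimizer ::
    "('n::finite \<Rightarrow> real \<Rightarrow> real) \<Rightarrow> real \<Rightarrow> real ^ 'n \<Rightarrow> bool" where
  "constrained_minimizer f C = is_arg_min (objective f) (\<lambda>z. (\<Sum>i\<in>UNIV. z $ i) = C)"

text \<open>
  In the algorithm \<open>\<tau>\<close> is the sequence of sampling instants. The derivative of \<open>\<xi>\<close> jumps at
  the sampling instants, so at \<open>\<tau> k\<close> the differential equation is understood from the right.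
  At \<open>t = 0\<close> the equation for \<open>x\<close> is trivially satisfied, so \<open>x 0\<close> is unconstrained.
\<close>

definition reduced_order_algorithm ::
    "('n::finite \<times> 'n) set \<Rightarrow> ('n \<Rightarrow> real \<Rightarrow> real) \<Rightarrow> real \<Rightarrow> (nat \<Rightarrow> real)
      \<Rightarrow> (real \<Rightarrow> real ^ 'n) \<Rightarrow> (real \<Rightarrow> real ^ 'n) \<Rightarrow> bool" where
  "reduced_order_algorithm E f \<beta> \<tau> x \<xi> \<longleftrightarrow>
     \<xi> 0 = 0 \<and>
     continuous_on (\<Union>k. {\<tau> k..<\<tau> (Suc k)}) \<xi> \<and>
     (\<forall>k. \<forall>t\<in>{\<tau> k..<\<tau> (Suc k)}. \<forall>i.
        x t $ i = x 0 $ i - (\<Sum>j\<in>UNIV. adjacency E $ i $ j * (\<xi> (\<tau> k) $ i - \<xi> (\<tau> k) $ j)) \<and>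
        ((\<lambda>s. \<xi> s $ i) has_real_derivative
           \<beta> / (\<tau> (Suc k) - \<tau> k) *
           (\<Sum>j\<in>UNIV. adjacency E $ i $ j *
              (deriv (f i) (x (\<tau> k) $ i) - deriv (f j) (x (\<tau> k) $ j))))
          (at t within {\<tau> k..<\<tau> (Suc k)}))"

definition sampling_interval :: "real \<Rightarrow> nat \<Rightarrow> real" where
  "sampling_interval Tc k = 6 / (pi * real k)\<^sup>2 * Tc"

definition sampling_instant :: "real \<Rightarrow> nat \<Rightarrow> real" where
  "sampling_instant Tc k = (\<Sum>j=1..k. sampling_interval Tc j)"

end

theory Submission
  imports Defs
begin

text \<open>
  At the sampling instants the algorithm is the recursion
  \<open>x\<^sub>k\<^sub>+\<^sub>1 = x\<^sub>k - \<beta> L (L g\<^sub>k)\<close> with \<open>g\<^sub>k\<close> the gradient at \<open>x\<^sub>k\<close>, so \<open>\<Sum>i. x\<^sub>k $ i\<close> is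
  conserved. The descent lemma and the bound on \<open>\<beta>\<close> give \<open>f x\<^sub>k\<^sub>+\<^sub>1 \<le> f x\<^sub>k - \<beta>/2 \<parallel>L g\<^sub>k\<parallel>\<^sup>2\<close>;
  as \<open>f\<close> is bounded below, \<open>L g\<^sub>k\<close> tends to \<open>0\<close>. Since the kernel of \<open>L\<close> consists of the
  constant vectors, \<open>\<bar>u \<bullet> v\<bar> \<le> K \<parallel>u\<parallel> \<parallel>L v\<parallel>\<close> whenever \<open>\<Sum>i. u $ i = 0\<close>. With strong convexity,
  \<open>l0 \<parallel>x\<^sub>k - x\<^sub>m\<parallel>\<^sup>2 \<le> (g\<^sub>k - g\<^sub>m) \<bullet> (x\<^sub>k - x\<^sub>m) \<le> K \<parallel>x\<^sub>k - x\<^sub>m\<parallel> \<parallel>L (g\<^sub>k - g\<^sub>m)\<parallel>\<close>, so \<open>x\<^sub>k\<close> is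
  a Cauchy sequence. At its limit the gradient is constant, which is the first-order optimality
  condition. Finally the sampling instants increase to \<open>Tc\<close> because \<open>\<Sum>k. 1/k\<^sup>2 = \<pi>\<^sup>2/6\<close>.
\<close>

section \<open>The Laplacian\<close>

text \<open>The right-hand side has the shape of the sums in the algorithm, so both of its equations
  turn into products with \<open>laplacian E\<close>.\<close>

lemma laplacian_mult_component:
  "(laplacian E *v v) $ i = (\<Sum>j\<in>UNIV. adjacency E $ i $ j * (v $ i - v $ j))"
proof -
  have "(laplacian E *v v) $ i
      = (\<Sum>j\<in>UNIV. (if i = j then (\<Sum>m\<in>UNIV. adjacency E $ i $ m) * v $ i else 0)
                   - adjacency E $ i $ j * v $ j)"
    by (simp add: matrix_vector_mult_def laplacian_def adjacency_def cong: if_cong)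
      (intro sum.cong, auto)
  also have "\<dots> = (\<Sum>j\<in>UNIV. adjacency E $ i $ j * (v $ i - v $ j))"
    by (simp add: sum_subtractf sum_distrib_right right_diff_distrib)
  finally show ?thesis .
qed

lemma adjacency_commute:
  assumes "undirected_graph E"
  shows "adjacency E $ i $ j = adjacency E $ j $ i"
  using assms by (auto simp: undirected_graph_def adjacency_def sym_def)

lemma inner_laplacian_commute:
  assumes "undirected_graph E"
  shows "v \<bullet> (laplacian E *v w) = (laplacian E *v v) \<bullet> w"
proof -
  have "transpose (laplacian E) = laplacian E"
    using adjacency_commute[OF assms] by (simp add: transpose_def laplacian_def vec_eq_iff)
  then show ?thesis
    by (metis dot_lmul_matrix transpose_matrix_vector)
qed

text \<open>The all-ones vector lies in the kernel, so by symmetry the image is orthogonal to it.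
  This is the source of the conserved sum.\<close>

lemma sum_laplacian_mult:
  assumes "undirected_graph E"
  shows "(\<Sum>i\<in>UNIV. (laplacian E *v v) $ i) = 0"
proof -
  have "laplacian E *v 1 = 0"
    by (simp add: vec_eq_iff laplacian_mult_component)
  then have "1 \<bullet> (laplacian E *v v) = 0"
    using inner_laplacian_commute[OF assms, of 1 v] by simp
  then show ?thesis by (simp add: inner_vec_def)
qed

text \<open>Exchanging the two summation indices and using symmetry gives a second expression for
  the same form; adding both produces the squares.\<close>

lemma laplacian_quadratic_form:
  assumes "undirected_graph E"
  shows "2 * (v \<bullet> (laplacian E *v v))
    = (\<Sum>i\<in>UNIV. \<Sum>j\<in>UNIV. adjacency E $ i $ j * (v $ i - v $ j)\<^sup>2)"
proof -
  let ?a = "\<lambda>i j. adjacency E $ i $ j"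
  have 1: "v \<bullet> (laplacian E *v v) = (\<Sum>i\<in>UNIV. \<Sum>j\<in>UNIV. ?a i j * (v $ i - v $ j) * v $ i)"
    by (simp add: inner_vec_def laplacian_mult_component sum_distrib_left sum_distrib_right mult_ac)
  also have "\<dots> = (\<Sum>j\<in>UNIV. \<Sum>i\<in>UNIV. ?a i j * (v $ i - v $ j) * v $ i)"
    by (rule sum.swap)
  also have "\<dots> = (\<Sum>i\<in>UNIV. \<Sum>j\<in>UNIV. ?a i j * (v $ j - v $ i) * v $ j)"
    using adjacency_commute[OF assms] by (intro sum.cong refl) metis
  finally have "2 * (v \<bullet> (laplacian E *v v))
      = (\<Sum>i\<in>UNIV. \<Sum>j\<in>UNIV. ?a i j * (v $ i - v $ j) * v $ i + ?a i j * (v $ j - v $ i) * v $ j)"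
    using 1 by (simp add: sum.distrib)
  also have "\<dots> = (\<Sum>i\<in>UNIV. \<Sum>j\<in>UNIV. ?a i j * (v $ i - v $ j)\<^sup>2)"
    by (intro sum.cong refl) (simp add: algebra_simps power2_eq_square)
  finally show ?thesis .
qed

text \<open>The quadratic form is a sum of nonnegative terms, so each of them vanishes and
  \<open>v\<close> agrees across every edge; connectedness carries the equality along paths.\<close>

lemma laplacian_kernel:
  assumes "undirected_graph E" "connected_graph E" and 0: "laplacian E *v v = 0"
  shows "v $ i = v $ j"
proof -
  have nonneg: "0 \<le> adjacency E $ i $ j * (v $ i - v $ j)\<^sup>2" for i j
    by (simp add: adjacency_def)
  have "(\<Sum>i\<in>UNIV. \<Sum>j\<in>UNIV. adjacency E $ i $ j * (v $ i - v $ j)\<^sup>2) = 0"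
    using laplacian_quadratic_form[OF assms(1), of v] 0 by simp
  then have "adjacency E $ i $ j * (v $ i - v $ j)\<^sup>2 = 0" for i j
    by (simp add: sum_nonneg_eq_0_iff sum_nonneg nonneg)
  then have edge: "v $ i = v $ j" if "(j, i) \<in> E" for i j
    using that \<open>adjacency E $ i $ j * (v $ i - v $ j)\<^sup>2 = 0\<close>
    by (cases "i = j") (simp_all add: adjacency_def)
  have "(i, j) \<in> E\<^sup>*"
    using assms(2) by (simp add: connected_graph_def)
  then show ?thesis
    by (induction rule: rtrancl_induct) (auto dest: edge)
qed

lemma laplacian_coercive:
  fixes E :: "('n::finite \<times> 'n) set"
  assumes "undirected_graph E" "connected_graph E"
  obtains K where "K > 0"
    "\<And>u v. (\<Sum>i\<in>UNIV. u $ i) = 0 \<Longrightarrow> \<bar>u \<bullet> v\<bar> \<le> K * norm u * norm (laplacian E *v v)"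
proof -
  let ?L = "laplacian E" and ?s = "\<lambda>v :: real ^ 'n. \<Sum>i\<in>UNIV. v $ i"
  \<comment> \<open>A rank-one perturbation makes the Laplacian injective without changing it on vectors of
      sum zero.\<close>
  define M where "M v = ?L *v v + ?s v *\<^sub>R 1" for v
  have lin: "linear M"
    by (rule linearI)
      (simp_all add: M_def matrix_vector_right_distrib sum.distrib scaleR_left_distrib
        scaleR_matrix_vector_assoc[symmetric] matrix_vector_mult_scaleR
        sum_distrib_left[symmetric] scaleR_right_distrib)
  have inj: "inj M"
    unfolding linear_injective_0[OF lin]
  proof (intro allI impI)
    fix v assume Mv: "M v = 0"
    \<comment> \<open>The Laplacian part has component sum zero, so only the perturbation remains in
      the sum.\<close>
    have "?s (M v) = CARD('n) * ?s v"
      using sum_laplacian_mult[OF assms(1), of v] by (simp add: M_def sum.distrib)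
    with Mv have s: "?s v = 0" by simp
    with Mv have "?L *v v = 0" by (simp add: M_def)
    then have const: "v $ i = v $ j" for i j
      using laplacian_kernel[OF assms] by blast
    have "v $ i = 0" for i
    proof -
      have "?s v = (\<Sum>j\<in>(UNIV::'n set). v $ i)" by (intro sum.cong refl const)
      with s show ?thesis by simp
    qed
    then show "v = 0" by (simp add: vec_eq_iff)
  qed
  \<comment> \<open>In finite dimension an injective linear map is bounded below; the constant
    \<open>K\<close> is the inverse of this bound.\<close>
  obtain B where B: "B > 0" "\<And>v. B * norm v \<le> norm (M v)"
    using linear_inj_bounded_below_pos[OF lin inj] by metis
  show thesis
  proof (rule that[of "1 / B"])
    show "1 / B > 0" using B by simp
    fix u v :: "real ^ 'n" assume u: "?s u = 0"
    \<comment> \<open>Removing the mean of \<open>v\<close> affects neither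
      \<open>u \<bullet> v\<close> nor the Laplacian image, and on vectors of sum zero
      \<open>M\<close> is the Laplacian.\<close>
    define w where "w = v - (?s v / CARD('n)) *\<^sub>R 1"
    have "?s w = 0"
      by (simp add: w_def sum_subtractf)
    moreover have "?L *v 1 = 0"
      by (simp add: vec_eq_iff laplacian_mult_component)
    then have "?L *v w = ?L *v v"
      by (simp add: w_def matrix_vector_mult_diff_distrib matrix_vector_mult_scaleR)
    ultimately have "B * norm w \<le> norm (?L *v v)"
      using B(2)[of w] by (simp add: M_def)
    then have w: "norm w \<le> norm (?L *v v) / B"
      using B(1) by (simp add: field_simps)
    have "u \<bullet> 1 = 0" using u by (simp add: inner_vec_def)
    then have "u \<bullet> v = u \<bullet> w" by (simp add: w_def inner_diff_right)
    then have "\<bar>u \<bullet> v\<bar> \<le> norm u * norm w" by (simp add: Cauchy_Schwarz_ineq2)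
    also have "\<dots> \<le> norm u * (norm (?L *v v) / B)" by (intro mult_left_mono w) simp
    finally show "\<bar>u \<bullet> v\<bar> \<le> 1 / B * norm u * norm (?L *v v)" by simp
  qed
qed

lemma norm_le_spectral_norm: "norm (M *v v) \<le> spectral_norm M * norm v"
  unfolding spectral_norm_def by (rule onorm) simp

section \<open>Separable objective functions\<close>

text \<open>The tangent inequality of convexity, by the mean value theorem. It serves twice below:
  for \<open>f i\<close> minus a quadratic and for a quadratic minus \<open>f i\<close>.\<close>

lemma mono_deriv_above_tangent:
  fixes F F' :: "real \<Rightarrow> real"
  assumes "\<And>s. (F has_real_derivative F' s) (at s)" "mono F'"
  shows "F y \<ge> F x + F' x * (y - x)"
proof (cases x y rule: linorder_cases)
  case less
  then obtain z where z: "x < z" "F y - F x = (y - x) * F' z"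
    using MVT2[of x y F F'] assms(1) by auto
  moreover have "(y - x) * F' x \<le> (y - x) * F' z"
    using less z monoD[OF assms(2), of x z] by (intro mult_left_mono) auto
  ultimately show ?thesis by (simp add: mult.commute)
next
  case greater
  then obtain z where z: "z < x" "F x - F y = (x - y) * F' z"
    using MVT2[of y x F F'] assms(1) by auto
  moreover have "(x - y) * F' z \<le> (x - y) * F' x"
    using greater z monoD[OF assms(2), of z x] by (intro mult_left_mono) auto
  ultimately show ?thesis by (simp add: algebra_simps)
qed simp

lemma norm_vec_power2: "(norm (v :: real ^ 'n::finite))\<^sup>2 = (\<Sum>i\<in>UNIV. (v $ i)\<^sup>2)"
  unfolding power2_norm_eq_inner by (simp add: inner_vec_def power2_eq_square)

lemma gradient_objective:
  fixes f :: "'n::finite \<Rightarrow> real \<Rightarrow> real"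
  assumes "\<And>i s. f i differentiable at s"
  shows "gradient (objective f) x = (\<chi> i. deriv (f i) (x $ i))"
  unfolding gradient_def
proof (rule the_equality)
  have d: "(f i has_real_derivative deriv (f i) s) (at s)" for i s
    using assms DERIV_deriv_iff_real_differentiable by blast
  have "((\<lambda>y. f i (y $ i)) has_derivative (\<lambda>h. h $ i * deriv (f i) (x $ i))) (at x)" for i
  proof -
    have "((\<lambda>y. y $ i) has_derivative (\<lambda>h. h $ i)) (at x)"
      by (intro bounded_linear_imp_has_derivative bounded_linear_vec_nth)
    from has_derivative_compose[OF this d[of i "x $ i", unfolded has_field_derivative_def]]
    show ?thesis by (simp add: mult.commute)
  qed
  then have "(objective f has_derivative (\<lambda>h. \<Sum>i\<in>UNIV. h $ i * deriv (f i) (x $ i))) (at x)"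
    unfolding objective_def by (intro has_derivative_sum)
  then show *: "GDERIV (objective f) x :> (\<chi> i. deriv (f i) (x $ i))"
    by (simp add: gderiv_def inner_vec_def)
  \<comment> \<open>\<open>gradient\<close> is a definite description, so uniqueness is required
    too: the derivative fixes the inner product of \<open>D\<close> with every vector.\<close>
  fix D assume "GDERIV (objective f) x :> D"
  with * have "(\<lambda>h. h \<bullet> D) = (\<lambda>h. h \<bullet> (\<chi> i. deriv (f i) (x $ i)))"
    unfolding gderiv_def by (rule has_derivative_unique[rotated])
  then show "D = (\<chi> i. deriv (f i) (x $ i))"
    by (metis vector_eq_ldot)
qed

section \<open>Consequences of the standing assumption\<close>

context
  fixes f :: "'n::finite \<Rightarrow> real \<Rightarrow> real" and l0 l :: real
  assumes standing: "standing_assumption f l0 l"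
begin

lemma standing_pos: "l0 > 0" "l > 0"
  using standing by (auto simp: standing_assumption_def)

lemma standing_gradient: "gradient (objective f) x = (\<chi> i. deriv (f i) (x $ i))"
  using standing by (intro gradient_objective) (simp add: standing_assumption_def)

lemma standing_DERIV: "(f i has_real_derivative deriv (f i) s) (at s)"
  using standing by (simp add: standing_assumption_def DERIV_deriv_iff_real_differentiable)

text \<open>Two points on the same coordinate axis have gradients that differ in that coordinate
  only, so the vector bound restricts to each \<open>f i\<close>.\<close>

lemma standing_deriv_Lipschitz: "\<bar>deriv (f i) s - deriv (f i) t\<bar> \<le> l * \<bar>s - t\<bar>"
proof -
  have "norm (gradient (objective f) (axis i s) - gradient (objective f) (axis i t))
      \<le> l * norm (axis i s - axis i t)"
    using standing by (simp add: standing_assumption_def)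
  moreover have "axis i s - axis i t = axis i (s - t)"
    by (simp add: vec_eq_iff axis_def)
  moreover have "gradient (objective f) (axis i s) - gradient (objective f) (axis i t)
      = axis i (deriv (f i) s - deriv (f i) t)"
    by (simp add: standing_gradient vec_eq_iff axis_def)
  ultimately show ?thesis by (simp add: norm_eq_sqrt_inner inner_axis_axis)
qed

text \<open>The bound on the second derivative makes \<open>f i\<close> convex even after
  subtraction of \<open>l0 / 2 * s\<^sup>2\<close>.\<close>

lemma standing_lower_scalar:
  "f i t \<ge> f i s + deriv (f i) s * (t - s) + l0 / 2 * (t - s)\<^sup>2"
proof -
  let ?F = "\<lambda>s. f i s - l0 / 2 * s\<^sup>2" and ?F' = "\<lambda>s. deriv (f i) s - l0 * s"
  have "(?F has_real_derivative ?F' s) (at s)" for s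
    by (auto intro!: derivative_eq_intros standing_DERIV)
  moreover have "mono ?F'"
  proof (rule monoI)
    fix a b :: real assume "a \<le> b"
    moreover have "((\<lambda>s. deriv (f i) s - l0 * s) has_real_derivative deriv (deriv (f i)) s - l0) (at s)"
      for s
      using standing
      by (auto intro!: derivative_eq_intros
          simp: standing_assumption_def DERIV_deriv_iff_real_differentiable)
    moreover have "deriv (deriv (f i)) s - l0 \<ge> 0" for s
      using standing by (simp add: standing_assumption_def)
    ultimately show "?F' a \<le> ?F' b"
      by (meson DERIV_nonneg_imp_nondecreasing)
  qed
  ultimately have "?F t \<ge> ?F s + ?F' s * (t - s)"
    by (rule mono_deriv_above_tangent)
  then show ?thesis by (simp add: algebra_simps power2_eq_square)
qed

text \<open>Mirror image of the lower bound: the Lipschitz derivative makes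
  \<open>l / 2 * s\<^sup>2 - f i s\<close> convex. Summed over the coordinates it is the descent
  lemma.\<close>

lemma standing_upper_scalar:
  "f i t \<le> f i s + deriv (f i) s * (t - s) + l / 2 * (t - s)\<^sup>2"
proof -
  let ?F = "\<lambda>s. l / 2 * s\<^sup>2 - f i s" and ?F' = "\<lambda>s. l * s - deriv (f i) s"
  have "(?F has_real_derivative ?F' s) (at s)" for s
    by (auto intro!: derivative_eq_intros standing_DERIV)
  moreover have "mono ?F'"
  proof (rule monoI)
    fix a b :: real assume "a \<le> b"
    with standing_deriv_Lipschitz[of i b a] show "?F' a \<le> ?F' b"
      by (simp add: right_diff_distrib)
  qed
  ultimately have "?F t \<ge> ?F s + ?F' s * (t - s)"
    by (rule mono_deriv_above_tangent)
  then show ?thesis by (simp add: algebra_simps power2_eq_square)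
qed

lemma objective_strongly_convex:
  "objective f y \<ge> objective f x + gradient (objective f) x \<bullet> (y - x) + l0 / 2 * (norm (y - x))\<^sup>2"
  unfolding objective_def standing_gradient norm_vec_power2 inner_vec_def
    sum_distrib_left sum.distrib[symmetric]
  by (intro sum_mono) (use standing_lower_scalar in simp)

lemma objective_smooth:
  "objective f y \<le> objective f x + gradient (objective f) x \<bullet> (y - x) + l / 2 * (norm (y - x))\<^sup>2"
  unfolding objective_def standing_gradient norm_vec_power2 inner_vec_def
    sum_distrib_left sum.distrib[symmetric]
  by (intro sum_mono) (use standing_upper_scalar in simp)

text \<open>Adding the strong convexity inequalities at \<open>x\<close> and at \<open>y\<close>
  cancels the function values.\<close>

lemma gradient_strongly_monotone:
  "l0 * (norm (y - x))\<^sup>2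
    \<le> (gradient (objective f) y - gradient (objective f) x) \<bullet> (y - x)"
  using objective_strongly_convex[of x y] objective_strongly_convex[of y x]
  by (simp add: inner_diff_left inner_diff_right norm_minus_commute)

lemma objective_bounded_below: "\<exists>b. \<forall>x. objective f x \<ge> b"
proof (intro exI allI)
  fix x :: "real ^ 'n"
  have "f i s \<ge> f i 0 - (deriv (f i) 0)\<^sup>2 / (2 * l0)" for i s
  proof -
    \<comment> \<open>Completing the square in the quadratic lower bound at 0.\<close>
    have "0 \<le> (l0 * s + deriv (f i) 0)\<^sup>2 / (2 * l0)"
      using standing_pos by simp
    also have "\<dots> = deriv (f i) 0 * s + l0 / 2 * s\<^sup>2 + (deriv (f i) 0)\<^sup>2 / (2 * l0)"
      using standing_pos by (simp add: field_simps power2_eq_square)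
    finally show ?thesis using standing_lower_scalar[of i 0 s] by simp
  qed
  then show "objective f x \<ge> (\<Sum>i\<in>UNIV. f i 0 - (deriv (f i) 0)\<^sup>2 / (2 * l0))"
    unfolding objective_def by (intro sum_mono)
qed

lemma gradient_tendsto:
  assumes "X \<longlonglongrightarrow> a"
  shows "(\<lambda>k. gradient (objective f) (X k)) \<longlonglongrightarrow> gradient (objective f) a"
proof (rule LIM_zero_cancel, rule Lim_null_comparison)
  show "\<forall>\<^sub>F k in sequentially.
      norm (gradient (objective f) (X k) - gradient (objective f) a) \<le> l * norm (X k - a)"
    using standing by (simp add: standing_assumption_def)
  show "(\<lambda>k. l * norm (X k - a)) \<longlonglongrightarrow> 0"
    using assms by (intro tendsto_mult_right_zero tendsto_norm_zero LIM_zero)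
qed

text \<open>A constant gradient (the Lagrange condition) is orthogonal to all differences of
  feasible points. Strong convexity then leaves quadratic growth away from \<open>a\<close>, which
  yields minimality and uniqueness together.\<close>

lemma constrained_minimizerI:
  assumes "(\<Sum>i\<in>UNIV. a $ i) = C"
    and const: "\<And>i j. gradient (objective f) a $ i = gradient (objective f) a $ j"
  shows "constrained_minimizer f C a" "constrained_minimizer f C z \<Longrightarrow> z = a"
proof -
  obtain c where c: "\<And>i. gradient (objective f) a $ i = c"
    using const by metis
  have growth: "objective f z \<ge> objective f a + l0 / 2 * (norm (z - a))\<^sup>2"
    if "(\<Sum>i\<in>UNIV. z $ i) = C" for z
  proof -
    have "gradient (objective f) a \<bullet> (z - a) = c * ((\<Sum>i\<in>UNIV. z $ i) - (\<Sum>i\<in>UNIV. a $ i))"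
      by (simp add: inner_vec_def c sum_distrib_left right_diff_distrib sum_subtractf)
    with that assms(1) show ?thesis
      using objective_strongly_convex[of a z] by simp
  qed
  have le: "objective f a \<le> objective f z" if "(\<Sum>i\<in>UNIV. z $ i) = C" for z
  proof -
    have "0 \<le> l0 / 2 * (norm (z - a))\<^sup>2" using standing_pos by simp
    with growth[OF that] show ?thesis by linarith
  qed
  show "constrained_minimizer f C a"
    using assms(1) le by (auto simp: constrained_minimizer_def is_arg_min_linorder)
  assume z: "constrained_minimizer f C z"
  then have "(\<Sum>i\<in>UNIV. z $ i) = C" "objective f z \<le> objective f a"
    using assms(1) by (auto simp: constrained_minimizer_def is_arg_min_linorder)
  with growth[of z] have "l0 / 2 * (norm (z - a))\<^sup>2 \<le> 0" by linarith
  then show "z = a"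
    using standing_pos by (simp add: mult_le_0_iff)
qed

text \<open>No minimizer is presupposed: the limit comes from completeness, and through its constant
  gradient it will supply the minimizer.\<close>

lemma laplacian_descent_tendsto:
  fixes X :: "nat \<Rightarrow> real ^ 'n"
  defines "g \<equiv> \<lambda>k. gradient (objective f) (X k)"
  assumes und: "undirected_graph E" and con: "connected_graph E"
    and \<beta>: "0 < \<beta>" "\<beta> \<le> 1 / (l * (spectral_norm (laplacian E))\<^sup>2)"
    and step: "\<And>k. X (Suc k) = X k - \<beta> *\<^sub>R (laplacian E *v (laplacian E *v g k))"
    and sumX: "\<And>k. (\<Sum>i\<in>UNIV. X k $ i) = C"
  obtains a where "X \<longlonglongrightarrow> a" "(\<Sum>i\<in>UNIV. a $ i) = C"
    "\<And>i j. gradient (objective f) a $ i = gradient (objective f) a $ j"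
proof -
  let ?L = "laplacian E"
  let ?S = "spectral_norm ?L"
  \<comment> \<open>Clearing the denominator requires \<open>?S\<close> nonzero; for
    \<open>?S = 0\<close> the left-hand side is 0.\<close>
  have \<beta>S: "\<beta> * l * ?S\<^sup>2 \<le> 1"
    using \<beta> standing_pos by (cases "?S = 0") (auto simp: field_simps)
  \<comment> \<open>The linear term gains \<open>\<beta> * (norm (?L *v g k))\<^sup>2\<close>; by
    the bound on \<open>\<beta>\<close> the quadratic term costs at most half of that.\<close>
  have desc: "objective f (X (Suc k)) \<le> objective f (X k) - \<beta> / 2 * (norm (?L *v g k))\<^sup>2" for k
  proof -
    have inner: "g k \<bullet> (X (Suc k) - X k) = - \<beta> * (norm (?L *v g k))\<^sup>2"
      by (simp add: step inner_laplacian_commute[OF und] power2_norm_eq_inner)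
    have "(norm (X (Suc k) - X k))\<^sup>2 = \<beta>\<^sup>2 * (norm (?L *v (?L *v g k)))\<^sup>2"
      by (simp add: step power_mult_distrib)
    also have "\<dots> \<le> \<beta>\<^sup>2 * (?S * norm (?L *v g k))\<^sup>2"
      by (intro mult_left_mono power_mono norm_le_spectral_norm) auto
    finally have "l / 2 * (norm (X (Suc k) - X k))\<^sup>2 \<le> l / 2 * (\<beta>\<^sup>2 * (?S * norm (?L *v g k))\<^sup>2)"
      using standing_pos by (intro mult_left_mono) auto
    also have "\<dots> = (\<beta> * l * ?S\<^sup>2) * (\<beta> / 2 * (norm (?L *v g k))\<^sup>2)"
      by (simp add: power2_eq_square)
    also have "\<dots> \<le> 1 * (\<beta> / 2 * (norm (?L *v g k))\<^sup>2)"
      using \<beta> by (intro mult_right_mono \<beta>S) auto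
    finally show ?thesis
      using objective_smooth[of "X (Suc k)" "X k"] inner by (simp add: g_def)
  qed
  have "decseq (\<lambda>k. objective f (X k))"
  proof (rule decseq_SucI)
    fix k
    have "0 \<le> \<beta> / 2 * (norm (?L *v g k))\<^sup>2" using \<beta> by simp
    with desc[of k] show "objective f (X (Suc k)) \<le> objective f (X k)" by linarith
  qed
  moreover obtain b where "\<And>x. objective f x \<ge> b"
    using objective_bounded_below by blast
  ultimately obtain p where p: "(\<lambda>k. objective f (X k)) \<longlonglongrightarrow> p"
    using decseq_convergent[of "\<lambda>k. objective f (X k)" b] by blast
  \<comment> \<open>Successive differences of a convergent sequence vanish; the factor
    \<open>2 / \<beta>\<close> makes them dominate the squared norm in \<open>desc\<close>.\<close>
  have "(\<lambda>k. (2 / \<beta>) * (objective f (X k) - objective f (X (Suc k)))) \<longlonglongrightarrow> (2 / \<beta>) * (p - p)"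
    by (intro tendsto_intros p LIMSEQ_Suc)
  then have lim: "(\<lambda>k. (2 / \<beta>) * (objective f (X k) - objective f (X (Suc k)))) \<longlonglongrightarrow> 0"
    by simp
  have "(\<lambda>k. (norm (?L *v g k))\<^sup>2) \<longlonglongrightarrow> 0"
  proof (rule tendsto_sandwich[OF _ _ tendsto_const lim])
    show "\<forall>\<^sub>F k in sequentially.
        (norm (?L *v g k))\<^sup>2 \<le> (2 / \<beta>) * (objective f (X k) - objective f (X (Suc k)))"
      using desc \<beta>(1) by (intro always_eventually allI) (simp add: field_simps)
  qed simp
  then have Lg: "(\<lambda>k. norm (?L *v g k)) \<longlonglongrightarrow> 0"
    by simp
  obtain K where K: "K > 0"
    "\<And>u v. (\<Sum>i\<in>UNIV. u $ i) = 0 \<Longrightarrow> \<bar>u \<bullet> v\<bar> \<le> K * norm u * norm (?L *v v)"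
    using laplacian_coercive[OF und con] by blast
  \<comment> \<open>Two iterates are compared with each other, which is possible as their difference
    has sum zero. The case split permits cancelling one factor of the norm.\<close>
  have dist: "l0 * norm (X k - X m) \<le> K * (norm (?L *v g k) + norm (?L *v g m))" for k m
  proof (cases "X k = X m")
    case True
    then show ?thesis using K by simp
  next
    case False
    have "l0 * (norm (X k - X m))\<^sup>2 \<le> \<bar>(X k - X m) \<bullet> (g k - g m)\<bar>"
      using gradient_strongly_monotone[of "X k" "X m"] by (simp add: g_def inner_commute)
    also have "\<dots> \<le> K * norm (X k - X m) * norm (?L *v (g k - g m))"
      by (intro K) (simp add: sum_subtractf sumX)
    also have "\<dots> \<le> K * norm (X k - X m) * (norm (?L *v g k) + norm (?L *v g m))"
      using K by (intro mult_left_mono) (simp_all add: matrix_vector_mult_diff_distrib norm_triangle_ineq4)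
    finally have "norm (X k - X m) * (l0 * norm (X k - X m))
        \<le> norm (X k - X m) * (K * (norm (?L *v g k) + norm (?L *v g m)))"
      by (simp add: power2_eq_square mult_ac)
    then show ?thesis using False by simp
  qed
  have "Cauchy X"
  proof (rule metric_CauchyI)
    fix e :: real assume "e > 0"
    then have "e * l0 / (2 * K) > 0" using K standing_pos by simp
    from LIMSEQ_D[OF Lg this] obtain N
      where N: "\<And>k. k \<ge> N \<Longrightarrow> norm (?L *v g k) < e * l0 / (2 * K)" by auto
    have "dist (X k) (X m) < e" if "k \<ge> N" "m \<ge> N" for k m
    proof -
      have "K * (norm (?L *v g k) + norm (?L *v g m)) < K * (e * l0 / (2 * K) + e * l0 / (2 * K))"
        using K N that by (intro mult_strict_left_mono add_strict_mono) auto
      also have "\<dots> = l0 * e" using K by (simp add: field_simps)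
      finally have "l0 * norm (X k - X m) < l0 * e" using dist[of k m] by linarith
      then show ?thesis using standing_pos by (simp add: dist_norm)
    qed
    then show "\<exists>N. \<forall>k\<ge>N. \<forall>m\<ge>N. dist (X k) (X m) < e" by blast
  qed
  then obtain a where a: "X \<longlonglongrightarrow> a"
    using Cauchy_convergent convergentD by blast
  show thesis
  proof (rule that[OF a])
    have "(\<lambda>k. \<Sum>i\<in>UNIV. X k $ i) \<longlonglongrightarrow> (\<Sum>i\<in>UNIV. a $ i)"
      by (intro tendsto_intros a)
    then show "(\<Sum>i\<in>UNIV. a $ i) = C"
      by (simp add: sumX LIMSEQ_const_iff)
    have "(\<lambda>k. ?L *v g k) \<longlonglongrightarrow> ?L *v gradient (objective f) a"
      unfolding g_def
      by (intro bounded_linear.tendsto[OF matrix_vector_mul_bounded_linear] gradient_tendsto a)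
    moreover have "(\<lambda>k. ?L *v g k) \<longlonglongrightarrow> 0"
      using Lg by (rule tendsto_norm_zero_cancel)
    ultimately have "?L *v gradient (objective f) a = 0"
      by (rule LIMSEQ_unique)
    then show "gradient (objective f) a $ i = gradient (objective f) a $ j" for i j
      by (rule laplacian_kernel[OF und con])
  qed
qed

end

section \<open>The sampling instants\<close>

lemma sampling_instant_Suc:
  "sampling_instant Tc (Suc k) = sampling_instant Tc k + sampling_interval Tc (Suc k)"
  by (simp add: sampling_instant_def)

lemma sampling_interval_pos: "Tc > 0 \<Longrightarrow> sampling_interval Tc (Suc k) > 0"
  by (simp add: sampling_interval_def)

lemma strict_mono_sampling_instant: "Tc > 0 \<Longrightarrow> strict_mono (sampling_instant Tc)"
  by (simp add: strict_mono_Suc_iff sampling_instant_Suc sampling_interval_pos)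

text \<open>The Basel sum normalises the total length of the intervals to \<open>Tc\<close>. Indices
  are shifted by one because the interval lengths start at index 1.\<close>

lemma sampling_instant_tendsto: "sampling_instant Tc \<longlonglongrightarrow> Tc"
proof -
  have "(\<lambda>k. 6 / pi\<^sup>2 * Tc * (1 / (real (Suc k))\<^sup>2)) sums (6 / pi\<^sup>2 * Tc * (pi\<^sup>2 / 6))"
    using inverse_squares_sums by (intro sums_mult) simp
  moreover have "(\<lambda>k. 6 / pi\<^sup>2 * Tc * (1 / (real (Suc k))\<^sup>2)) = (\<lambda>k. sampling_interval Tc (Suc k))"
    by (simp add: sampling_interval_def power_mult_distrib)
  ultimately have "(\<lambda>k. sampling_interval Tc (Suc k)) sums Tc" by simp
  moreover have "sampling_instant Tc = (\<lambda>n. \<Sum>k<n. sampling_interval Tc (Suc k))"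
    by (simp add: sampling_instant_def fun_eq_iff sum.atLeast1_atMost_eq)
  ultimately show ?thesis by (simp add: sums_def)
qed

text \<open>The interval ends at the first instant beyond \<open>t\<close>. Keeping
  \<open>k \<ge> m\<close> lets times close to \<open>T\<close> be matched with large
  indices.\<close>

lemma in_sampling_interval:
  assumes "strict_mono \<tau>" "\<tau> \<longlonglongrightarrow> T" "\<tau> m \<le> t" "t < (T::real)"
  obtains k where "k \<ge> m" "t \<in> {\<tau> k..<\<tau> (Suc k)}"
proof -
  have "\<forall>\<^sub>F n in sequentially. t < \<tau> n"
    using assms(2,4) by (rule order_tendstoD)
  then obtain n where "t < \<tau> n" by (auto simp: eventually_sequentially)
  then have least: "t < \<tau> (LEAST n. t < \<tau> n)" by (rule LeastI)
  have "m < (LEAST n. t < \<tau> n)"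
    using least assms(1,3) by (metis le_less_trans strict_mono_less)
  then obtain k where k: "(LEAST n. t < \<tau> n) = Suc k" "k \<ge> m"
    by (metis Suc_le_D Suc_le_mono Suc_leI)
  then have "\<tau> k \<le> t"
    using not_less_Least[of k "\<lambda>n. t < \<tau> n"] by simp
  then show thesis using that k least by simp
qed

section \<open>The sampled recursion\<close>

context
  fixes E :: "('n::finite \<times> 'n) set" and f :: "'n \<Rightarrow> real \<Rightarrow> real" and \<beta> :: real
    and \<tau> :: "nat \<Rightarrow> real" and x \<xi> :: "real \<Rightarrow> real ^ 'n"
  assumes alg: "reduced_order_algorithm E f \<beta> \<tau> x \<xi>" and mono: "strict_mono \<tau>"
begin

text \<open>The right-hand side is free of \<open>t\<close>: the state is constant between sampling
  instants and only \<open>\<xi>\<close> moves.\<close>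

lemma reduced_order_state:
  assumes "t \<in> {\<tau> k..<\<tau> (Suc k)}"
  shows "x t = x 0 - laplacian E *v \<xi> (\<tau> k)"
  using alg assms
  by (auto simp: reduced_order_algorithm_def vec_eq_iff laplacian_mult_component)

lemma left_end_mem: "\<tau> k \<in> {\<tau> k..<\<tau> (Suc k)}"
  using mono by (simp add: strict_mono_Suc_iff)

text \<open>The slope of \<open>\<xi>\<close> is constant on each interval, and its factor
  \<open>1 / (\<tau> (Suc k) - \<tau> k)\<close> cancels the length of the interval.\<close>

lemma reduced_order_xi_step:
  "\<xi> (\<tau> (Suc k)) = \<xi> (\<tau> k) + \<beta> *\<^sub>R (laplacian E *v (\<chi> i. deriv (f i) (x (\<tau> k) $ i)))"
proof -
  have lt: "\<tau> k < \<tau> (Suc k)" using left_end_mem[of k] by simp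
  \<comment> \<open>The right end belongs to the next half-open interval, so continuity of
    \<open>\<xi>\<close> reaches the closed interval.\<close>
  have "{\<tau> k..\<tau> (Suc k)} \<subseteq> {\<tau> k..<\<tau> (Suc k)} \<union> {\<tau> (Suc k)..<\<tau> (Suc (Suc k))}"
    using left_end_mem[of "Suc k"] by auto
  also have "\<dots> \<subseteq> (\<Union>k. {\<tau> k..<\<tau> (Suc k)})" by blast
  finally have cont: "continuous_on {\<tau> k..\<tau> (Suc k)} \<xi>"
    using alg continuous_on_subset by (auto simp: reduced_order_algorithm_def)
  have "\<xi> (\<tau> (Suc k)) $ i
      = \<xi> (\<tau> k) $ i + \<beta> * (laplacian E *v (\<chi> i. deriv (f i) (x (\<tau> k) $ i))) $ i" for i
  proof -
    define S where "S = (laplacian E *v (\<chi> i. deriv (f i) (x (\<tau> k) $ i))) $ i"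
    define D where "D = \<beta> / (\<tau> (Suc k) - \<tau> k) * S"
    let ?h = "\<lambda>s. \<xi> s $ i - D * s"
    have "?h (\<tau> (Suc k)) = ?h (\<tau> k)"
    proof (rule DERIV_isconst_end[OF lt])
      show "continuous_on {\<tau> k..\<tau> (Suc k)} ?h"
        by (intro continuous_intros cont)
      fix s assume s: "\<tau> k < s" "s < \<tau> (Suc k)"
      then have "((\<lambda>s. \<xi> s $ i) has_real_derivative D) (at s within {\<tau> k..<\<tau> (Suc k)})"
        using alg by (simp add: reduced_order_algorithm_def D_def S_def laplacian_mult_component)
      then have "((\<lambda>s. \<xi> s $ i) has_real_derivative D) (at s within {\<tau> k<..<\<tau> (Suc k)})"
        by (rule DERIV_subset) auto
      then have "((\<lambda>s. \<xi> s $ i) has_real_derivative D) (at s)"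
        using s by (simp add: at_within_open[of s "{\<tau> k<..<\<tau> (Suc k)}"])
      then show "(?h has_real_derivative 0) (at s)"
        by (auto intro!: derivative_eq_intros)
    qed
    then have "\<xi> (\<tau> (Suc k)) $ i = \<xi> (\<tau> k) $ i + D * (\<tau> (Suc k) - \<tau> k)"
      by (simp add: algebra_simps)
    then show ?thesis using lt by (simp add: D_def S_def)
  qed
  then show ?thesis by (simp add: vec_eq_iff)
qed

lemma reduced_order_state_step:
  "x (\<tau> (Suc k)) = x (\<tau> k)
    - \<beta> *\<^sub>R (laplacian E *v (laplacian E *v (\<chi> i. deriv (f i) (x (\<tau> k) $ i))))"
  using reduced_order_state[OF left_end_mem, of k] reduced_order_state[OF left_end_mem, of "Suc k"]
  by (simp add: reduced_order_xi_step matrix_vector_right_distrib matrix_vector_mult_scaleR)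

end

theorem theorem2:
  fixes E :: "('n::finite \<times> 'n) set"
    and f :: "'n \<Rightarrow> real \<Rightarrow> real"
    and l0 l Tc C \<beta> :: real
    and x \<xi> :: "real \<Rightarrow> real ^ 'n"
  assumes "CARD('n) \<ge> 2"
    and "undirected_graph E"
    and "connected_graph E"
    and "standing_assumption f l0 l"
    and "Tc > 0"
    and "C = (\<Sum>i\<in>UNIV. x 0 $ i)"
    and "0 < \<beta>"
    and "\<beta> \<le> 1 / (l * (spectral_norm (laplacian E))\<^sup>2)"
    and "reduced_order_algorithm E f \<beta> (sampling_instant Tc) x \<xi>"
  shows "\<exists>xstar. constrained_minimizer f C xstar \<and>
           (\<forall>z. constrained_minimizer f C z \<longrightarrow> z = xstar) \<and>
           (x \<longlongrightarrow> xstar) (at_left Tc) \<and>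
           (\<forall>t\<in>{0..Tc}. (\<Sum>i\<in>UNIV. (x(Tc := Lim (at_left Tc) x)) t $ i) = C)"
proof -
  let ?\<tau> = "sampling_instant Tc"
  let ?X = "\<lambda>k. x (?\<tau> k)"
  note und = assms(2) and con = assms(3) and standing = assms(4) and Tc = assms(5)
  note mono = strict_mono_sampling_instant[OF Tc] and lim = sampling_instant_tendsto[of Tc]
  note state = reduced_order_state[OF assms(9) mono]
  have sampled: "x t = ?X k" if "t \<in> {?\<tau> k..<?\<tau> (Suc k)}" for t k
    using state[OF that] state[OF left_end_mem[OF assms(9) mono], of k] by simp
  have locate: "\<exists>k\<ge>m. t \<in> {?\<tau> k..<?\<tau> (Suc k)}" if "?\<tau> m \<le> t" "t < Tc" for m t
    using in_sampling_interval[OF mono lim that] by metis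
  have \<tau>0: "?\<tau> 0 = 0" by (simp add: sampling_instant_def)
  have sum: "(\<Sum>i\<in>UNIV. x t $ i) = C" if t: "0 \<le> t" "t < Tc" for t
  proof -
    obtain k where "t \<in> {?\<tau> k..<?\<tau> (Suc k)}" using locate[of 0 t] t unfolding \<tau>0 by blast
    then show ?thesis
      using sum_laplacian_mult[OF und, of "\<xi> (?\<tau> k)"] assms(6) by (simp add: state sum_subtractf)
  qed
  have \<tau>_less: "?\<tau> k < Tc" for k
    \<comment> \<open>The limit bounds the instant \<open>Suc k\<close>, and strict monotonicity
      makes the inequality strict at \<open>k\<close>.\<close>
    using mono lim incseq_le[of ?\<tau> Tc "Suc k"] strict_monoD[OF mono, of k "Suc k"]
    by (simp add: strict_mono_mono less_le_trans)
  have \<tau>_nonneg: "0 \<le> ?\<tau> k" for k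
    using mono \<tau>0 by (metis le0 strict_mono_less_eq)
  obtain a where a: "?X \<longlonglongrightarrow> a" "(\<Sum>i\<in>UNIV. a $ i) = C"
    "\<And>i j. gradient (objective f) a $ i = gradient (objective f) a $ j"
  proof (rule laplacian_descent_tendsto[OF standing und con assms(7,8), of ?X C])
    show "x (?\<tau> (Suc k)) = x (?\<tau> k)
        - \<beta> *\<^sub>R (laplacian E *v (laplacian E *v gradient (objective f) (x (?\<tau> k))))" for k
      using reduced_order_state_step[OF assms(9) mono] by (simp add: standing_gradient[OF standing])
    show "(\<Sum>i\<in>UNIV. x (?\<tau> k) $ i) = C" for k
      by (rule sum[OF \<tau>_nonneg \<tau>_less])
  qed blast
  have x_lim: "(x \<longlongrightarrow> a) (at_left Tc)"
  proof (rule tendstoI)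
    fix e :: real assume "e > 0"
    then obtain N where N: "\<And>k. k \<ge> N \<Longrightarrow> dist (?X k) a < e"
      using a(1) by (auto simp: lim_sequentially)
    \<comment> \<open>Beyond the instant \<open>N\<close> the state equals a sample of index at
      least \<open>N\<close>, so the sequential limit becomes the left limit.\<close>
    have "\<forall>\<^sub>F t in at_left Tc. t \<in> {?\<tau> N<..<Tc}"
      using \<tau>_less by (rule eventually_at_left_real)
    then show "\<forall>\<^sub>F t in at_left Tc. dist (x t) a < e"
    proof eventually_elim
      case (elim t)
      then obtain k where "k \<ge> N" "t \<in> {?\<tau> k..<?\<tau> (Suc k)}" using locate[of N t] by auto
      with N sampled show ?case by metis
    qed
  qed
  then have "Lim (at_left Tc) x = a"
    by (intro tendsto_Lim) auto
  then have "\<forall>t\<in>{0..Tc}. (\<Sum>i\<in>UNIV. (x(Tc := Lim (at_left Tc) x)) t $ i) = C"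
    using sum a(2) by auto
  with x_lim constrained_minimizerI[OF standing a(2,3)] show ?thesis by blast
qed

end
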